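(* Let $\gamma,\beta,\lambda\in\mathbb{N}_0$ and $\alpha\in\mathbb{N}$ with $\alpha\mid\beta$ and $\alpha\mid\gamma$. Then for every integer $n\ge 0$, $$\omega_{n}(x;\alpha,\beta,\gamma,\lambda)=\sum_{i=0}^{n}\binom{n}{i}\,\mathcal{B}^{0,x}_{i,\lambda}(\alpha,\beta,\gamma)\sum_{l=0}^{n-i}\beta^{l}\,S(n-i,l,\alpha,\beta,0)\,x^{l}\lambda^{l}.$$
   Context: $\mathbb{N}$ is the set of positive integers and $\mathbb{N}_0=\mathbb{N}\cup\{0\}$; $x$ is a variable (when a nonnegative integer, a number of colours); $0^0=1$. Factorial polynomials: $(t|\alpha)_n=\prod_{j=0}^{n-1}(t-j\alpha)$, with $(t|\alpha)_0=1$. Powers such as $(1+\alpha t)^{c/\alpha}$ denote the formal power series $\sum_{n\ge0}(c|\alpha)_n\,t^n/n!$. Generalized Stirling numbers $S(n,k,\alpha,\beta,\gamma)$ ($0\le k\le n$) are defined by the polynomial identity $$(t|\alpha)_n=\sum_{k=0}^{n}S(n,k,\alpha,\beta,\gamma)\,(t-\gamma|\beta)_k ,$$ and $S(n,k,\alpha,\beta,\gamma)=0$ for $k>n$. The numbers $\mathcal{B}^{r,x}_{n,\lambda}(\alpha,\beta,\gamma)$ (here used with $r=0$) and the polynomials $\omega_n(x;\alpha,\beta,\gamma,\lambda)$ are defined by the formal power series identities, with $u(t)=x\big((1+\alpha t)^{\beta/\alpha}-1\big)$, $$\sum_{n=0}^{\infty}\mathcal{B}^{r,x}_{n,\lambda}(\alpha,\beta,\gamma)\frac{t^n}{n!}=(1+\alpha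 t)^{\gamma/\alpha}\,\frac{u(t)^{r\lambda}\exp(-\lambda u(t))}{(1-u(t))^{(r+1)\lambda}},$$ $$\sum_{n=0}^{\infty}\omega_n(x;\alpha,\beta,\gamma,\lambda)\frac{t^n}{n!}=\frac{(1+\alpha t)^{\gamma/\alpha}}{(1-u(t))^{\lambda}}.$$ *)

theory Defs
  imports
    "HOL-Computational_Algebra.Polynomial"
    "HOL-Computational_Algebra.Formal_Power_Series"
begin

text \<open>
  The factorial polynomial $(t|\alpha)_n$. It is stated over an arbitrary commutative ring, so that
  \<open>t\<close> can be a scalar or the polynomial variable \<open>[:0, 1:]\<close>.
\<close>

definition gfact :: "'a::comm_ring_1 \<Rightarrow> 'a \<Rightarrow> nat \<Rightarrow> 'a" where
  "gfact t \<alpha> n = (\<Prod>j<n. t - of_nat j * \<alpha>)"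

text \<open>The polynomials $(t-\gamma|\beta)_k$ in the variable $t$ are \<open>gfact [:-\<gamma>, 1:] [:\<beta>:] k\<close>.\<close>

definition is_gen_stirling_row ::
  "nat \<Rightarrow> 'a::field_char_0 \<Rightarrow> 'a \<Rightarrow> 'a \<Rightarrow> (nat \<Rightarrow> 'a) \<Rightarrow> bool" where
  "is_gen_stirling_row n \<alpha> \<beta> \<gamma> s \<longleftrightarrow>
     gfact [:0, 1:] [:\<alpha>:] n = (\<Sum>k\<le>n. smult (s k) (gfact [:-\<gamma>, 1:] [:\<beta>:] k)) \<and>
     (\<forall>k>n. s k = 0)"

definition gen_stirling :: "nat \<Rightarrow> nat \<Rightarrow> 'a::field_char_0 \<Rightarrow> 'a \<Rightarrow> 'a \<Rightarrow> 'a" where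
  "gen_stirling n k \<alpha> \<beta> \<gamma> = (THE s. is_gen_stirling_row n \<alpha> \<beta> \<gamma> s) k"

lemma monic_gfact:
  fixes \<beta> c :: "'a::field_char_0"
  shows "degree (gfact [:c, 1:] [:\<beta>:] k) = k \<and> coeff (gfact [:c, 1:] [:\<beta>:] k) k = 1"
proof (induction k)
  case 0
  then show ?case by (simp add: gfact_def)
next
  case (Suc k)
  let ?p = "gfact [:c, 1:] [:\<beta>:] k" and ?q = "[:c - of_nat k * \<beta>, 1:]"
  have eq: "gfact [:c, 1:] [:\<beta>:] (Suc k) = ?p * ?q"
    by (simp add: gfact_def of_nat_poly mult.commute)
  have nz: "?p \<noteq> 0" using Suc by auto
  have d: "degree (?p * ?q) = Suc k"
    using Suc nz by (subst degree_mult_eq) auto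
  have "coeff (?p * ?q) (Suc k) = lead_coeff (?p * ?q)" using d by simp
  also have "\<dots> = lead_coeff ?p * lead_coeff ?q" by (rule lead_coeff_mult)
  also have "\<dots> = 1" using Suc by simp
  finally show ?case using d eq by simp
qed

lemma ex1_monic_expansion:
  fixes q :: "nat \<Rightarrow> 'a::field_char_0 poly"
  assumes q: "\<And>k. degree (q k) = k" "\<And>k. coeff (q k) k = 1"
  shows "degree p \<le> n \<Longrightarrow> \<exists>!s. p = (\<Sum>k\<le>n. smult (s k) (q k)) \<and> (\<forall>k>n. s k = 0)"
proof (induction n arbitrary: p)
  case 0
  have q0: "q 0 = 1"
    using q[of 0] by (metis degree_eq_zeroE coeff_pCons_0 one_pCons)
  obtain a where a: "p = [:a:]" using 0 by (metis degree_eq_zeroE le_zero_eq)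
  show ?case
  proof (rule ex1I[of _ "\<lambda>k. if k = 0 then a else 0"])
    fix s assume "p = (\<Sum>k\<le>0. smult (s k) (q k)) \<and> (\<forall>k>0. s k = 0)"
    then show "s = (\<lambda>k. if k = 0 then a else 0)" using a q0 by (auto simp: fun_eq_iff one_pCons)
  qed (use a q0 in \<open>auto simp: one_pCons\<close>)
next
  case (Suc n)
  let ?c = "coeff p (Suc n)"
  let ?r = "p - smult ?c (q (Suc n))"
  have "degree ?r \<le> n"
  proof (rule degree_le, intro allI impI)
    fix i assume "n < i"
    show "coeff ?r i = 0"
    proof (cases "i = Suc n")
      case False
      then have "coeff p i = 0" "coeff (q (Suc n)) i = 0"
        using \<open>n < i\<close> Suc.prems q(1)[of "Suc n"] by (auto intro!: coeff_eq_0)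
      then show ?thesis by simp
    qed (use q(2) in simp)
  qed
  from Suc.IH[OF this] obtain s
    where s: "?r = (\<Sum>k\<le>n. smult (s k) (q k))" "\<forall>k>n. s k = 0"
      and uniq: "\<And>s'. ?r = (\<Sum>k\<le>n. smult (s' k) (q k)) \<and> (\<forall>k>n. s' k = 0) \<Longrightarrow> s' = s"
    by (elim ex1E) blast
  show ?case
  proof (rule ex1I[of _ "s(Suc n := ?c)"], intro conjI)
    have "(\<Sum>k\<le>Suc n. smult ((s(Suc n := ?c)) k) (q k)) =
        (\<Sum>k\<le>n. smult (s k) (q k)) + smult ?c (q (Suc n))" by simp
    also have "\<dots> = ?r + smult ?c (q (Suc n))" unfolding s(1) ..
    finally show "p = (\<Sum>k\<le>Suc n. smult ((s(Suc n := ?c)) k) (q k))" by simp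
  next
    show "\<forall>k>Suc n. (s(Suc n := ?c)) k = 0" using s(2) by simp
  next
    fix s' assume s': "p = (\<Sum>k\<le>Suc n. smult (s' k) (q k)) \<and> (\<forall>k>Suc n. s' k = 0)"
    have "coeff (\<Sum>k\<le>n. smult (s' k) (q k)) (Suc n) = 0"
      by (auto simp: coeff_sum q(1) intro!: sum.neutral coeff_eq_0)
    moreover have p: "p = (\<Sum>k\<le>n. smult (s' k) (q k)) + smult (s' (Suc n)) (q (Suc n))"
      using s' by simp
    ultimately have c: "?c = s' (Suc n)"
      by (metis (no_types, lifting) add_0 coeff_add coeff_smult mult.right_neutral q(2))
    have "?r = (\<Sum>k\<le>n. smult (s' k) (q k))"
      unfolding c by (subst p) simp
    also have "\<dots> = (\<Sum>k\<le>n. smult ((s'(Suc n := 0)) k) (q k))"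
      by (rule sum.cong) auto
    finally have "?r = (\<Sum>k\<le>n. smult ((s'(Suc n := 0)) k) (q k))" .
    moreover have "\<forall>k>n. (s'(Suc n := 0)) k = 0" using s' by auto
    ultimately have "s'(Suc n := 0) = s" using uniq by blast
    then show "s' = s(Suc n := ?c)" using c by auto
  qed
qed

text \<open>The defining polynomial identity of the generalized Stirling numbers.\<close>

lemma gen_stirling_row:
  "is_gen_stirling_row n \<alpha> \<beta> \<gamma> (\<lambda>k. gen_stirling n k \<alpha> \<beta> (\<gamma> :: 'a::field_char_0))"
proof -
  have "\<exists>!s. is_gen_stirling_row n \<alpha> \<beta> \<gamma> s"
    unfolding is_gen_stirling_row_def
    by (rule ex1_monic_expansion) (simp_all add: monic_gfact)
  from theI'[OF this] show ?thesis unfolding gen_stirling_def by simp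
qed

text \<open>
  The formal power series $(1+\alpha t)^{c/\alpha}$. No division by \<open>\<alpha>\<close> takes place;
  for \<open>\<alpha> = 0\<close> this is \<open>fps_exp c\<close>.
\<close>

definition fps_gpow :: "'a::field_char_0 \<Rightarrow> 'a \<Rightarrow> 'a fps" where
  "fps_gpow \<alpha> c = Abs_fps (\<lambda>n. gfact c \<alpha> n / fact n)"

definition useries :: "'a::field_char_0 \<Rightarrow> 'a \<Rightarrow> 'a \<Rightarrow> 'a fps" where
  "useries x \<alpha> \<beta> = fps_const x * (fps_gpow \<alpha> \<beta> - 1)"

text \<open>
  The constant term of \<open>useries\<close> is zero. Hence the composition with the exponential series is
  the intended one, and the denominators below are units in the ring of formal power series.
\<close>

lemma useries_nth_0 [simp]: "fps_nth (useries x \<alpha> \<beta>) 0 = 0"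
  by (simp add: useries_def fps_gpow_def gfact_def)

definition Bnum ::
  "nat \<Rightarrow> 'a::field_char_0 \<Rightarrow> nat \<Rightarrow> nat \<Rightarrow> 'a \<Rightarrow> 'a \<Rightarrow> 'a \<Rightarrow> 'a" where
  "Bnum r x n lam \<alpha> \<beta> \<gamma> =
     fact n * fps_nth
       (fps_gpow \<alpha> \<gamma> *
         (useries x \<alpha> \<beta> ^ (r * lam) * (fps_exp 1 oo (- of_nat lam * useries x \<alpha> \<beta>)) /
          (1 - useries x \<alpha> \<beta>) ^ ((r + 1) * lam))) n"

definition omega_poly ::
  "nat \<Rightarrow> 'a::field_char_0 \<Rightarrow> 'a \<Rightarrow> 'a \<Rightarrow> 'a \<Rightarrow> nat \<Rightarrow> 'a" where
  "omega_poly n x \<alpha> \<beta> \<gamma> lam =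
     fact n * fps_nth (fps_gpow \<alpha> \<gamma> / (1 - useries x \<alpha> \<beta>) ^ lam) n"

end

theory Submission
  imports Defs
begin

text \<open>
  Multiplying the generating function of \<open>Bnum 0 x _ lam\<close> by $\exp(\lambda u)$ gives that of
  \<open>omega_poly\<close>, so everything rests on
  $(G-1)^l/l! = \beta^l \sum_m S(m,l,\alpha,\beta,0)\,t^m/m!$ for $G = (1+\alpha t)^{\beta/\alpha}$.
  Both sides have the same binomial transform in $l$: expanding $G^k = (1+(G-1))^k$ on the one hand,
  and $G^k = (1+\alpha t)^{k\beta/\alpha}$ together with the defining identity of the Stirling
  numbers at the point $k\beta$ on the other.
\<close>

lemma gfact_eq_gbinomial:
  fixes c \<alpha> :: "'a::field_char_0"
  assumes "\<alpha> \<noteq> 0"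
  shows "gfact c \<alpha> n = fact n * ((c / \<alpha>) gchoose n) * \<alpha> ^ n"
proof -
  have "gfact c \<alpha> n = (\<Prod>j<n. (c / \<alpha> - of_nat j) * \<alpha>)"
    unfolding gfact_def using assms by (intro prod.cong) (auto simp: field_simps)
  also have "\<dots> = (\<Prod>j<n. c / \<alpha> - of_nat j) * \<alpha> ^ n"
    by (simp add: prod.distrib)
  also have "(\<Prod>j<n. c / \<alpha> - of_nat j) = fact n * ((c / \<alpha>) gchoose n)"
    by (simp add: gbinomial_prod_rev atLeast0LessThan)
  finally show ?thesis .
qed

text \<open>At integer multiples of \<open>\<beta>\<close> the factorial polynomials become binomial
  coefficients, so the Stirling expansion at such a point is itself a binomial transform.\<close>

lemma gfact_multiple:
  "gfact (of_nat k * \<beta>) \<beta> l = \<beta> ^ l * (fact l * of_nat (k choose l) :: 'a::field_char_0)"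
proof -
  have "gfact (of_nat k * \<beta>) \<beta> l = (\<Prod>j<l. \<beta> * (of_nat k - of_nat j))"
    unfolding gfact_def by (intro prod.cong) (auto simp: algebra_simps)
  also have "\<dots> = \<beta> ^ l * (\<Prod>j<l. of_nat k - of_nat j)"
    by (simp add: prod.distrib)
  also have "(\<Prod>j<l. of_nat k - of_nat j :: 'a) = fact l * of_nat (k choose l)"
    by (simp add: binomial_gbinomial gbinomial_prod_rev atLeast0LessThan)
  finally show ?thesis .
qed

lemma poly_gfact: "poly (gfact p [:\<beta>:] n) t = gfact (poly p t) \<beta> n"
  by (simp add: gfact_def poly_prod mult.commute)

lemma gfact_gen_stirling:
  fixes t :: "'a::field_char_0"
  shows "gfact t \<alpha> n = (\<Sum>k\<le>n. gen_stirling n k \<alpha> \<beta> \<gamma> * gfact (t - \<gamma>) \<beta> k)"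
proof -
  have "poly (gfact [:0, 1:] [:\<alpha>:] n) t =
      poly (\<Sum>k\<le>n. smult (gen_stirling n k \<alpha> \<beta> \<gamma>) (gfact [:-\<gamma>, 1:] [:\<beta>:] k)) t"
    using gen_stirling_row[of n \<alpha> \<beta> \<gamma>] unfolding is_gen_stirling_row_def by simp
  then show ?thesis by (simp add: poly_gfact poly_sum)
qed

lemma gen_stirling_eq_0: "n < k \<Longrightarrow> gen_stirling n k \<alpha> \<beta> \<gamma> = 0"
  using gen_stirling_row[of n \<alpha> \<beta> \<gamma>] by (simp add: is_gen_stirling_row_def)

lemma fps_gpow_0 [simp]: "fps_gpow \<alpha> 0 = 1"
proof (rule fps_ext)
  fix n show "fps_nth (fps_gpow \<alpha> 0) n = fps_nth 1 n"
    by (cases n) (simp_all add: fps_gpow_def gfact_def prod.lessThan_Suc_shift del: prod.lessThan_Suc)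
qed

text \<open>The substitution of \<open>\<alpha> t\<close> for \<open>t\<close> in the binomial
  series with exponent \<open>c / \<alpha>\<close>; the exponent law of that series then carries
  over to \<open>fps_gpow\<close>.\<close>

lemma fps_gpow_eq_binomial:
  assumes "\<alpha> \<noteq> 0"
  shows "fps_gpow \<alpha> c = fps_binomial (c / \<alpha>) oo (fps_const \<alpha> * fps_X)"
  by (rule fps_ext)
     (simp add: fps_gpow_def gfact_eq_gbinomial[OF assms] fps_compose_linear)

lemma fps_gpow_add:
  assumes "\<alpha> \<noteq> 0"
  shows "fps_gpow \<alpha> (a + b) = fps_gpow \<alpha> a * fps_gpow \<alpha> b"
  by (simp add: fps_gpow_eq_binomial[OF assms] add_divide_distrib fps_binomial_add_mult
      fps_compose_mult_distrib)

lemma fps_gpow_power: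
  assumes "\<alpha> \<noteq> 0"
  shows "fps_gpow \<alpha> \<beta> ^ k = fps_gpow \<alpha> (of_nat k * \<beta>)"
  by (induction k) (simp_all add: fps_gpow_add[OF assms] algebra_simps)

text \<open>The transform is unitriangular: the term \<open>l = k\<close> has coefficient 1, and
  strong induction cancels all the lower terms.\<close>

lemma binomial_transform_inj:
  fixes f g :: "nat \<Rightarrow> 'a::comm_ring_1"
  assumes "\<And>k. (\<Sum>l\<le>k. of_nat (k choose l) * f l) = (\<Sum>l\<le>k. of_nat (k choose l) * g l)"
  shows "f k = g k"
proof (induction k rule: less_induct)
  case (less k)
  have "(\<Sum>l<k. of_nat (k choose l) * f l) = (\<Sum>l<k. of_nat (k choose l) * g l)"
    using less by (intro sum.cong) auto
  then show ?case
    using assms[of k] by (simp flip: lessThan_Suc_atMost)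
qed

lemma fps_gpow_minus_1_power_nth:
  fixes \<alpha> \<beta> :: "'a::field_char_0"
  assumes "\<alpha> \<noteq> 0"
  shows "fps_nth ((fps_gpow \<alpha> \<beta> - 1) ^ l) m =
    fact l * \<beta> ^ l * gen_stirling m l \<alpha> \<beta> 0 / fact m"
\<comment> \<open>Both sides are read as functions of \<open>l\<close>, with \<open>m\<close>
  fixed.\<close>
proof (rule binomial_transform_inj[where k = l])
  fix k
  let ?S = "\<lambda>l. gen_stirling m l \<alpha> \<beta> 0"
  let ?h = "\<lambda>l. of_nat (k choose l) * (fact l * \<beta> ^ l * ?S l / fact m)"
  have "(\<Sum>l\<le>k. of_nat (k choose l) * fps_nth ((fps_gpow \<alpha> \<beta> - 1) ^ l) m) =
      fps_nth (((fps_gpow \<alpha> \<beta> - 1) + 1) ^ k) m"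
    unfolding binomial_ring by (simp add: fps_sum_nth fps_mult_of_nat_nth)
  also have "\<dots> = gfact (of_nat k * \<beta>) \<alpha> m / fact m"
    by (simp add: fps_gpow_power[OF assms]) (simp add: fps_gpow_def)
  also have "\<dots> = (\<Sum>l\<le>m. ?h l)"
    by (subst gfact_gen_stirling[of _ _ _ \<beta> 0], simp only: diff_zero gfact_multiple)
       (simp add: sum_divide_distrib mult_ac)
  \<comment> \<open>The range changes from \<open>m\<close> to \<open>k\<close> through a common
    upper bound: the Stirling numbers vanish for \<open>l > m\<close>, the binomial coefficients for
    \<open>l > k\<close>.\<close>
  also have "\<dots> = (\<Sum>l\<le>max k m. ?h l)"
    by (intro sum.mono_neutral_left) (auto simp: gen_stirling_eq_0)
  also have "\<dots> = (\<Sum>l\<le>k. ?h l)"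
    by (intro sum.mono_neutral_right) (auto simp: binomial_eq_0)
  finally show "(\<Sum>l\<le>k. of_nat (k choose l) * fps_nth ((fps_gpow \<alpha> \<beta> - 1) ^ l) m) =
    (\<Sum>l\<le>k. ?h l)" .
qed

text \<open>The coefficient \<open>1 / fact l\<close> of the exponential series cancels the
  \<open>fact l\<close> in the coefficients of
  \<open>(fps_gpow \<alpha> \<beta> - 1) ^ l\<close>.\<close>

lemma fps_exp_useries_nth:
  fixes x \<alpha> \<beta> c :: "'a::field_char_0"
  assumes "\<alpha> \<noteq> 0"
  shows "fps_nth (fps_exp 1 oo (fps_const c * useries x \<alpha> \<beta>)) m =
    (\<Sum>l=0..m. \<beta> ^ l * gen_stirling m l \<alpha> \<beta> 0 * x ^ l * c ^ l) / fact m"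
proof -
  have "(fps_const c * useries x \<alpha> \<beta>) ^ l =
      fps_const ((c * x) ^ l) * (fps_gpow \<alpha> \<beta> - 1) ^ l" for l
    by (simp add: useries_def power_mult_distrib fps_const_power flip: mult.assoc)
  then show ?thesis
    by (simp add: fps_compose_nth fps_gpow_minus_1_power_nth[OF assms] sum_divide_distrib
        power_mult_distrib mult_ac)
qed

lemma fps_exp_compose_uminus_mult:
  fixes w :: "'a::field_char_0 fps"
  assumes "fps_nth w 0 = 0"
  shows "(fps_exp 1 oo - w) * (fps_exp 1 oo w) = 1"
proof -
  have "- w = fps_const (- 1) * w"
    by (simp add: fps_eq_iff)
  then have "(- w) ^ l = fps_const ((- 1) ^ l) * w ^ l" for l
    by (simp only: power_mult_distrib fps_const_power)
  \<comment> \<open>Moving the sign to the outer series gives both factors the same inner series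
    \<open>w\<close>, so multiplicativity of composition applies.\<close>
  then have "fps_exp (1::'a) oo - w = fps_exp (- 1) oo w"
    by (intro fps_ext) (simp add: fps_compose_nth)
  then show ?thesis
    using assms by (simp add: fps_exp_add_mult[symmetric] flip: fps_compose_mult_distrib)
qed

text \<open>The two exponentials are inverse to each other. The exponents \<open>0 * lam\<close> and
  \<open>(0 + 1) * lam\<close> keep the shape of \<open>Bnum\<close> at \<open>r = 0\<close>, so
  that coefficients match after unfolding.\<close>

lemma fps_omega_eq_Bnum_mult_exp:
  fixes x \<alpha> \<beta> \<gamma> :: "'a::field_char_0"
  defines "u \<equiv> useries x \<alpha> \<beta>"
  shows "fps_gpow \<alpha> \<gamma> / (1 - u) ^ lam =
    fps_gpow \<alpha> \<gamma> * (u ^ (0 * lam) * (fps_exp 1 oo (- of_nat lam * u)) / (1 - u) ^ ((0 + 1) * lam)) *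
    (fps_exp 1 oo (fps_const (of_nat lam) * u))"
proof -
  \<comment> \<open>The denominator is a unit, so the division is multiplication by its
    inverse.\<close>
  have nz: "fps_nth ((1 - u) ^ lam) 0 \<noteq> 0"
    by (simp add: u_def fps_power_zeroth)
  have "(fps_exp 1 oo (- of_nat lam * u)) * (fps_exp 1 oo (fps_const (of_nat lam) * u)) = 1"
    using fps_exp_compose_uminus_mult[of "of_nat lam * u"]
    by (simp add: u_def fps_of_nat)
  then show ?thesis
    using nz by (simp add: fps_divide_unit mult_ac)
qed

theorem theorem3p3:
  fixes x :: "'a::field_char_0" and \<alpha> \<beta> \<gamma> lam n :: nat
  assumes "\<alpha> > 0" and "\<alpha> dvd \<beta>" and "\<alpha> dvd \<gamma>"
  shows "omega_poly n x (of_nat \<alpha>) (of_nat \<beta>) (of_nat \<gamma>) lam =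
    (\<Sum>i=0..n. of_nat (n choose i) * Bnum 0 x i lam (of_nat \<alpha>) (of_nat \<beta>) (of_nat \<gamma>) *
       (\<Sum>l=0..n - i. of_nat \<beta> ^ l * gen_stirling (n - i) l (of_nat \<alpha>) (of_nat \<beta>) 0 *
          x ^ l * of_nat lam ^ l))"
proof -
  have \<alpha>: "(of_nat \<alpha> :: 'a) \<noteq> 0" using assms(1) by simp
  show ?thesis
    unfolding omega_poly_def Bnum_def
    \<comment> \<open>In the Cauchy product, \<open>fact n\<close> splits as
      \<open>n choose i\<close> times \<open>fact i\<close>, which belongs to \<open>Bnum\<close>,
      times \<open>fact (n - i)\<close>, which cancels the denominator of the exponential
      factor.\<close>
    by (subst fps_omega_eq_Bnum_mult_exp, subst fps_mult_nth, subst sum_distrib_left, rule sum.cong)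
       (simp_all only: fps_exp_useries_nth[OF \<alpha>] binomial_fact atLeastAtMost_iff, simp)
qed

end
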